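(* For every integer $m\ge 1$ it holds that $\mathcal N(m,0)=m^2$.
   Context: Let $(\Omega,\nu)$ be a measure space and let $\mathcal F\subseteq L_2(\Omega,\nu)$ be an $m$-dimensional complex function space on which pointwise function evaluations are well-defined (i.e. the elements are genuine functions $\Omega\to\mathbb C$ and $\|\cdot\|_{L_2}$ is a norm on $\mathcal F$). For $0\le\varepsilon<1$, distinct points $x_1,\dots,x_n\in\Omega$ and positive weights $w_1,\dots,w_n>0$ satisfy the weighted $L_2$ Marcinkiewicz--Zygmund (MZ) inequality on $\mathcal F$ with distortion $\varepsilon$ if $$(1-\varepsilon)\|f\|_{L_2}^2\le\sum_{i=1}^n w_i|f(x_i)|^2\le(1+\varepsilon)\|f\|_{L_2}^2\quad\text{for all } f\in\mathcal F.$$ Write $\mathcal F\in\mathcal M_+^w(n,\varepsilon)$ if such points and weights exist. Define $$\mathcal N(m,\varepsilon)=\sup_{(\Omega,\nu),\,\mathcal F}\min\{n\in\mathbb N:\mathcal F\in\mathcal M_+^w(n,\varepsilon)\},$$ where the supremum is over all measure spaces $(\Omega,\nu)$ and all $m$-dimensional complex function spaces $\mathcal F\subseteq L_2(\Omega,\nu)$ on which pointwise function evaluations are well-defined (i.e. the elements are genuine functions $\Omega\to\mathbb C$ and $\|\cdot\|_{L_2}$ is a norm on $\mathcal F$). *)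

theory Defs
  imports "HOL-Analysis.Analysis" "HOL-Library.Extended_Nat" "HOL-Library.Function_Algebras"
begin

definition cfun_scale :: "complex \<Rightarrow> ('a \<Rightarrow> complex) \<Rightarrow> 'a \<Rightarrow> complex" where
  "cfun_scale c f = (\<lambda>x. c * f x)"

global_interpretation cfun: vector_space cfun_scale
  by standard (auto simp: cfun_scale_def fun_eq_iff algebra_simps)

definition L2_norm_on :: "'a measure \<Rightarrow> ('a \<Rightarrow> complex) \<Rightarrow> real" where
  "L2_norm_on \<nu> f = sqrt (LINT x|\<nu>. (cmod (f x))\<^sup>2)"

text \<open>
  A function \<open>\<Omega> \<rightarrow> \<complex>\<close>, with \<open>\<Omega> = space \<nu>\<close>, is represented by its extension by zero to the whole
  type, so that equality in the type is equality of functions on \<open>\<Omega>\<close>. Elements of these spaces are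
  genuine functions, not classes modulo null sets.
\<close>

definition L2_functions :: "'a measure \<Rightarrow> ('a \<Rightarrow> complex) set" where
  "L2_functions \<nu> = {f. f \<in> borel_measurable \<nu> \<and> integrable \<nu> (\<lambda>x. (cmod (f x))\<^sup>2) \<and>
     (\<forall>x. x \<notin> space \<nu> \<longrightarrow> f x = 0)}"

definition is_norm_on :: "(('a \<Rightarrow> complex) \<Rightarrow> real) \<Rightarrow> ('a \<Rightarrow> complex) set \<Rightarrow> bool" where
  "is_norm_on N F \<longleftrightarrow>
     (\<forall>f\<in>F. 0 \<le> N f) \<and>
     (\<forall>f\<in>F. N f = 0 \<longleftrightarrow> f = 0) \<and>
     (\<forall>c. \<forall>f\<in>F. N (cfun_scale c f) = cmod c * N f) \<and>
     (\<forall>f\<in>F. \<forall>g\<in>F. N (f + g) \<le> N f + N g)"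

definition L2_function_space :: "nat \<Rightarrow> 'a measure \<Rightarrow> ('a \<Rightarrow> complex) set \<Rightarrow> bool" where
  "L2_function_space m \<nu> F \<longleftrightarrow>
     F \<subseteq> L2_functions \<nu> \<and>
     (\<exists>B. finite B \<and> card B = m \<and> cfun.independent B \<and> cfun.span B = F) \<and>
     is_norm_on (L2_norm_on \<nu>) F"

definition MZ_inequality ::
  "'a measure \<Rightarrow> ('a \<Rightarrow> complex) set \<Rightarrow> real \<Rightarrow> nat \<Rightarrow> (nat \<Rightarrow> 'a) \<Rightarrow> (nat \<Rightarrow> real) \<Rightarrow> bool" where
  "MZ_inequality \<nu> F \<epsilon> n x w \<longleftrightarrow>
     (\<forall>f\<in>F. (1 - \<epsilon>) * (L2_norm_on \<nu> f)\<^sup>2 \<le> (\<Sum>i<n. w i * (cmod (f (x i)))\<^sup>2) \<and>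
            (\<Sum>i<n. w i * (cmod (f (x i)))\<^sup>2) \<le> (1 + \<epsilon>) * (L2_norm_on \<nu> f)\<^sup>2)"

text \<open>\<open>MZ_class \<nu> n \<epsilon>\<close> is \<open>\<M>\<^sub>+\<^sup>w(n, \<epsilon>)\<close> for function spaces on \<open>(\<Omega>, \<nu>)\<close>.\<close>

definition MZ_class :: "'a measure \<Rightarrow> nat \<Rightarrow> real \<Rightarrow> ('a \<Rightarrow> complex) set set" where
  "MZ_class \<nu> n \<epsilon> = {F. \<exists>x w. inj_on x {..<n} \<and> (\<forall>i<n. x i \<in> space \<nu>) \<and> (\<forall>i<n. 0 < w i) \<and>
     MZ_inequality \<nu> F \<epsilon> n x w}"

text \<open>
  The infimum in \<^typ>\<open>enat\<close> is the minimum if some \<open>n\<close> is admissible and \<open>\<infinity>\<close> otherwise. HOL cannot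
  quantify over types inside a term, so the supremum ranges over the measure spaces whose points
  are taken from a given type \<^typ>\<open>'a\<close>, which plays the role of a universe; \<open>\<Omega> = space \<nu>\<close> can be
  any subset of it.
\<close>

definition MZ_number :: "'a itself \<Rightarrow> nat \<Rightarrow> real \<Rightarrow> enat" where
  "MZ_number _ m \<epsilon> =
     (SUP (\<nu>, F) \<in> {(\<nu> :: 'a measure, F). L2_function_space m \<nu> F}.
        INF n \<in> {n. F \<in> MZ_class \<nu> n \<epsilon>}. enat n)"

end

theory Submission imports Defs begin

text \<open>
  Upper bound. Let \<open>b\<^sub>0, \<dots>, b\<^sub>m\<^sub>-\<^sub>1\<close> be a basis of \<open>F\<close>. For \<open>f \<in> F\<close>, the function \<open>\<bar>f\<bar>\<^sup>2\<close> is a real linear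
  combination of the \<open>m\<^sup>2\<close> integrable real functions \<open>Re (b\<^sub>i cnj b\<^sub>j)\<close> for \<open>i \<le> j\<close> and
  \<open>Im (b\<^sub>i cnj b\<^sub>j)\<close> for \<open>j < i\<close>. A quadrature formula with positive weights that is exact for these
  functions is therefore an MZ inequality with distortion \<open>0\<close>, and Tchakaloff's theorem
  (\<open>Tchakaloff_quadrature\<close>) provides one with at most \<open>m\<^sup>2\<close> nodes on any measure space, without any
  topological assumption.

  Tchakaloff's theorem says that the vector \<open>y\<close> of the integrals of \<open>f\<^sub>1, \<dots>, f\<^sub>N\<close> lies in the
  convex cone generated by the vectors \<open>(f\<^sub>1 x, \<dots>, f\<^sub>N x)\<close>; the bound on the number of nodes is then
  Caratheodory's theorem for cones (\<open>conic_Caratheodory\<close>). To get into the cone and not only into its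
  closure, the points \<open>x\<close> are first restricted to a set of full measure on which every linear
  relation that holds almost everywhere holds everywhere (\<open>AE_relations_everywhere\<close>). After that, a
  linear form that is nonnegative on the cone is nonnegative at \<open>y\<close>, and if it vanishes at \<open>y\<close>, then
  it vanishes on the whole cone. A vector with this property belongs to the cone
  (\<open>dual_interior_subset_cone\<close>): the property survives the intersection of the cone with a
  hyperplane through \<open>0\<close> and \<open>y\<close> (\<open>dual_interior_hyperplane\<close>), and if \<open>y \<noteq> 0\<close>, then after enough
  intersections the cone has shrunk to a part of the line through \<open>0\<close> and \<open>y\<close>.

  Lower bound. On \<open>m\<^sup>2\<close> points labelled by pairs \<open>(i, j)\<close>, with counting measure, consider the
  functions that map a point to a fixed linear form evaluated at \<open>e\<^sub>i\<close> if \<open>i = j\<close>, at \<open>e\<^sub>i + e\<^sub>j\<close> if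
  \<open>i < j\<close>, and at \<open>e\<^sub>i + \<i> e\<^sub>j\<close> if \<open>j < i\<close>. By polarization the squared moduli of these functions
  span all real functions on the \<open>m\<^sup>2\<close> points (\<open>pair_basis_separating\<close>). Hence an exact formula must
  reproduce the counting measure, so each point is a node.
\<close>

section \<open>Convex cones and their relative interior\<close>

text \<open>
  The dual description of the relative interior of a convex cone \<open>C\<close>: each linear form that is
  nonnegative on \<open>C\<close> is nonnegative at \<open>y\<close>, and vanishes at \<open>y\<close> only if it vanishes on \<open>C\<close>. Vectors
  are families of reals indexed by \<open>I\<close>, because the dimension is a variable of the argument; a
  linear form is given by its coefficients \<open>a\<close>, and coordinates outside \<open>I\<close> are ignored.
\<close>

definition dual_interior :: "'i set \<Rightarrow> ('i \<Rightarrow> real) set \<Rightarrow> ('i \<Rightarrow> real) \<Rightarrow> bool" where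
  "dual_interior I C y \<longleftrightarrow> (\<forall>a. (\<forall>c\<in>C. 0 \<le> (\<Sum>k\<in>I. a k * c k)) \<longrightarrow>
     0 \<le> (\<Sum>k\<in>I. a k * y k) \<and> ((\<Sum>k\<in>I. a k * y k) = 0 \<longrightarrow> (\<forall>c\<in>C. (\<Sum>k\<in>I. a k * c k) = 0)))"

lemma dual_interiorD:
  assumes "dual_interior I C y" "\<And>c. c \<in> C \<Longrightarrow> 0 \<le> (\<Sum>k\<in>I. a k * c k)"
  shows "0 \<le> (\<Sum>k\<in>I. a k * y k)"
    and "(\<Sum>k\<in>I. a k * y k) = 0 \<Longrightarrow> c \<in> C \<Longrightarrow> (\<Sum>k\<in>I. a k * c k) = 0"
  using assms(1)[unfolded dual_interior_def, THEN spec[of _ a]] assms(2) by blast+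

text \<open>
  Convex cones of coordinate families. The origin is an element, so that the empty quadrature
  formula is covered.
\<close>

definition coord_cone :: "('i \<Rightarrow> real) set \<Rightarrow> bool" where
  "coord_cone C \<longleftrightarrow> (\<forall>c\<in>C. \<forall>d\<in>C. (\<lambda>k. c k + d k) \<in> C) \<and>
     (\<forall>c\<in>C. \<forall>s>0. (\<lambda>k. s * c k) \<in> C) \<and> (\<lambda>_. 0) \<in> C"

lemma coord_cone_hyperplane:
  assumes "coord_cone C"
  shows "coord_cone {c\<in>C. (\<Sum>k\<in>I. h k * c k) = 0}"
proof -
  have "(\<Sum>k\<in>I. h k * (s * c k)) = s * (\<Sum>k\<in>I. h k * c k)" for s c
    by (simp add: sum_distrib_left algebra_simps)
  then show ?thesis
    using assms by (auto simp: coord_cone_def distrib_left sum.distrib)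
qed

text \<open>
  The property passes to the section of \<open>C\<close> by a hyperplane through \<open>0\<close> and \<open>y\<close>. A linear form \<open>b\<close> that is
  nonnegative on the section becomes nonnegative on \<open>C\<close> after a multiple \<open>t h\<close> of the form defining
  the hyperplane is added, and this changes neither \<open>b y\<close> nor \<open>b\<close> on the section.
\<close>

lemma dual_interior_hyperplane:
  assumes cone: "coord_cone C" and int: "dual_interior I C y"
    and hy: "(\<Sum>k\<in>I. h k * y k) = 0"
  shows "dual_interior I {c\<in>C. (\<Sum>k\<in>I. h k * c k) = 0} y"
  unfolding dual_interior_def
proof (intro allI impI)
  define L where "L a c = (\<Sum>k\<in>I. a k * c k)" for a c :: "'a \<Rightarrow> real"
  have L_add: "L (\<lambda>k. a k + t * a' k) c = L a c + t * L a' c" for a a' c t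
    by (simp add: L_def sum.distrib algebra_simps sum_distrib_left)
  have L_comb: "L a (\<lambda>k. s * c k + t * d k) = s * L a c + t * L a d" for a c d s t
    by (simp add: L_def sum.distrib algebra_simps sum_distrib_left)
  have L_neg: "L (\<lambda>k. - a k) c = - L a c" for a c
    by (simp add: L_def sum_negf)
  have int': "0 \<le> L a y \<and> (L a y = 0 \<longrightarrow> (\<forall>c\<in>C. L a c = 0))" if "\<forall>c\<in>C. 0 \<le> L a c" for a
    using dual_interiorD[OF int, of a] that unfolding L_def by blast
  fix b assume "\<forall>c\<in>{c\<in>C. (\<Sum>k\<in>I. h k * c k) = 0}. 0 \<le> (\<Sum>k\<in>I. b k * c k)"
  then have b: "0 \<le> L b c" if "c \<in> C" "L h c = 0" for c
    using that by (simp add: L_def)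
  have hy': "L h y = 0" using hy by (simp add: L_def)
  have add: "(\<lambda>k. c k + d k) \<in> C" if "c \<in> C" "d \<in> C" for c d
    using cone that unfolding coord_cone_def by blast
  have scale: "(\<lambda>k. s * c k) \<in> C" if "c \<in> C" "s > 0" for c s
    using cone that unfolding coord_cone_def by blast
  have "\<exists>t. \<forall>c\<in>C. 0 \<le> L b c + t * L h c"
  proof (cases "(\<exists>c\<in>C. L h c > 0) \<and> (\<exists>c\<in>C. L h c < 0)")
    case False
    then have "(\<forall>c\<in>C. 0 \<le> L h c) \<or> (\<forall>c\<in>C. 0 \<le> L (\<lambda>k. - h k) c)"
      unfolding L_neg by (auto simp: not_less)
    then have "\<forall>c\<in>C. L h c = 0"
    proof
      assume "\<forall>c\<in>C. 0 \<le> L h c"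
      from int'[OF this] hy' show ?thesis by blast
    next
      assume "\<forall>c\<in>C. 0 \<le> L (\<lambda>k. - h k) c"
      from int'[OF this] hy' show ?thesis unfolding L_neg by simp
    qed
    then show ?thesis using b by auto
  next
    case True
    then obtain p q where p: "p \<in> C" "L h p > 0" and q: "q \<in> C" "L h q < 0" by blast
    \<comment> \<open>Points on the positive side of the hyperplane bound \<open>t\<close> from below and points on the negative
      side bound it from above. The bounds are consistent, because \<open>b\<close> is nonnegative at the point
      where the segment between two such points crosses the hyperplane.\<close>
    have le: "- L b c / L h c \<le> L b d / (- L h d)"
      if c: "c \<in> C" "L h c > 0" and d: "d \<in> C" "L h d < 0" for c d
    proof -
      let ?e = "\<lambda>k. (- L h d) * c k + L h c * d k"
      have "(\<lambda>k. (- L h d) * c k) \<in> C" "(\<lambda>k. L h c * d k) \<in> C"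
        using scale[of c "- L h d"] scale[of d "L h c"] c d by simp_all
      then have "?e \<in> C" by (rule add)
      moreover have "L h ?e = 0" unfolding L_comb by simp
      ultimately have "0 \<le> (- L h d) * L b c + L h c * L b d"
        using b[of ?e] unfolding L_comb by simp
      then show ?thesis using c(2) d(2) by (simp add: field_simps)
    qed
    define X where "X = (\<lambda>c. - L b c / L h c) ` {c\<in>C. L h c > 0}"
    define t where "t = Sup X"
    have ne: "X \<noteq> {}" using p by (auto simp: X_def)
    have up: "t \<le> L b d / (- L h d)" if "d \<in> C" "L h d < 0" for d
      unfolding t_def by (rule cSup_least[OF ne]) (use le that in \<open>auto simp: X_def\<close>)
    have bdd: "bdd_above X"
      by (rule bdd_aboveI[of _ "L b q / (- L h q)"]) (use le q in \<open>auto simp: X_def\<close>)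
    have low: "- L b c / L h c \<le> t" if "c \<in> C" "L h c > 0" for c
      unfolding t_def by (rule cSup_upper[OF _ bdd]) (use that in \<open>auto simp: X_def\<close>)
    have "0 \<le> L b c + t * L h c" if c: "c \<in> C" for c
    proof (cases "L h c" "0::real" rule: linorder_cases)
      case less
      then show ?thesis using up[OF c less] by (simp add: field_simps)
    next
      case equal
      then show ?thesis using b c by simp
    next
      case greater
      then show ?thesis using low[OF c greater] by (simp add: field_simps)
    qed
    then show ?thesis by blast
  qed
  then obtain t where "\<forall>c\<in>C. 0 \<le> L (\<lambda>k. b k + t * h k) c" by (auto simp: L_add)
  from int'[OF this] hy' have "0 \<le> L b y" "L b y = 0 \<longrightarrow> (\<forall>c\<in>C. L b c + t * L h c = 0)"
    by (auto simp: L_add)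
  then show "0 \<le> (\<Sum>k\<in>I. b k * y k) \<and> ((\<Sum>k\<in>I. b k * y k) = 0 \<longrightarrow>
      (\<forall>c\<in>{c\<in>C. (\<Sum>k\<in>I. h k * c k) = 0}. (\<Sum>k\<in>I. b k * c k) = 0))"
    by (auto simp flip: L_def)
qed

lemma dual_interior_subset_cone:
  assumes fin: "finite I" and cone: "coord_cone C" and int: "dual_interior I C y"
  shows "\<exists>c\<in>C. \<forall>k\<in>I. c k = y k"
proof (cases "\<forall>k\<in>I. y k = 0")
  case True
  then show ?thesis using cone unfolding coord_cone_def by (intro bexI[of _ "\<lambda>_. 0"]) auto
next
  case False
  then obtain p where p: "p \<in> I" "y p \<noteq> 0" by blast
  have single: "(\<Sum>j\<in>I. of_bool (j = k) * c j) = c k" if "k \<in> I" for k and c :: "'a \<Rightarrow> real"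
    using that fin by (subst sum.remove[of _ k]) (auto intro!: sum.neutral)
  \<comment> \<open>The forms \<open>h k\<close> vanish at \<open>y\<close>, and their common kernel is the line through \<open>0\<close> and
    \<open>y\<close>.\<close>
  define h where "h k j = y p * of_bool (j = k) - y k * of_bool (j = p)" for k j
  have h: "(\<Sum>j\<in>I. h k j * c j) = y p * c k - y k * c p" if "k \<in> I" for k c
    using that p(1)
    by (simp add: h_def left_diff_distrib sum_subtractf mult.assoc single flip: sum_distrib_left)
  have cut: "coord_cone {c\<in>C. \<forall>k\<in>J. (\<Sum>j\<in>I. h k j * c j) = 0} \<and>
      dual_interior I {c\<in>C. \<forall>k\<in>J. (\<Sum>j\<in>I. h k j * c j) = 0} y" if "finite J" "J \<subseteq> I" for J
    using that
  proof (induction J rule: finite_induct)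
    case empty
    then show ?case using cone int by simp
  next
    case (insert i J)
    let ?D = "{c\<in>C. \<forall>k\<in>J. (\<Sum>j\<in>I. h k j * c j) = 0}"
    have eq: "{c\<in>C. \<forall>k\<in>insert i J. (\<Sum>j\<in>I. h k j * c j) = 0} = {c\<in>?D. (\<Sum>j\<in>I. h i j * c j) = 0}"
      by auto
    have "(\<Sum>j\<in>I. h i j * y j) = 0" using insert.prems by (simp add: h)
    moreover have "coord_cone ?D" "dual_interior I ?D y" using insert by auto
    ultimately show ?case
      unfolding eq using coord_cone_hyperplane dual_interior_hyperplane by blast
  qed
  define D where "D = {c\<in>C. \<forall>k\<in>I. y p * c k = y k * c p}"
  have D: "D = {c\<in>C. \<forall>k\<in>I. (\<Sum>j\<in>I. h k j * c j) = 0}" by (auto simp: D_def h)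
  have cD: "coord_cone D" and iD: "dual_interior I D y" using cut[OF fin] by (auto simp: D)
  \<comment> \<open>Otherwise the form \<open>c \<mapsto> - y p * c p\<close> would be nonnegative on \<open>D\<close> and negative at \<open>y\<close>.\<close>
  have "\<exists>c\<in>D. 0 < y p * c p"
  proof (rule ccontr)
    assume "\<not> ?thesis"
    then have neg: "y p * c p \<le> 0" if "c \<in> D" for c using that by (meson not_less)
    have eval: "(\<Sum>k\<in>I. - y p * of_bool (k = p) * c k) = - (y p * c p)" for c
      using single[OF p(1), of "\<lambda>k. - y p * c k"] by (simp add: mult_ac)
    have "0 \<le> (\<Sum>k\<in>I. - y p * of_bool (k = p) * y k)"
      by (rule dual_interiorD(1)[OF iD]) (simp only: eval neg neg_0_le_iff_le)
    then have "y p * y p \<le> 0" unfolding eval by simp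
    moreover have "0 < y p * y p" using p(2) by (auto simp: zero_less_mult_iff linorder_neq_iff)
    ultimately show False by simp
  qed
  then obtain c where c: "c \<in> D" "0 < y p * c p" by blast
  have "y p / c p > 0" using c(2) by (simp add: zero_less_mult_iff zero_less_divide_iff)
  then have "(\<lambda>k. y p / c p * c k) \<in> C"
    using c(1) cone unfolding D_def coord_cone_def by blast
  moreover have "y p / c p * c k = y k" if "k \<in> I" for k
    using c that by (auto simp: D_def field_simps)
  ultimately show ?thesis by (intro bexI[of _ "\<lambda>k. y p / c p * c k"]) auto
qed

section \<open>Tchakaloff's theorem\<close>

text \<open>
  The set \<open>S\<close> works for all coefficient vectors \<open>a\<close> at once. This is not immediate, since there are
  uncountably many relations, but finitely many of them span all. In the induction, one relation
  with a nonzero coefficient at the new index suffices to reduce all others to the old indices.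
\<close>

lemma AE_relations_everywhere:
  fixes f :: "'i \<Rightarrow> 'a \<Rightarrow> real"
  assumes "finite I"
  shows "\<exists>S. (AE x in M. x \<in> S) \<and>
    (\<forall>a. (AE x in M. (\<Sum>k\<in>I. a k * f k x) = 0) \<longrightarrow> (\<forall>x\<in>S. (\<Sum>k\<in>I. a k * f k x) = 0))"
  using assms
proof (induction I rule: finite_induct)
  case empty
  then show ?case by (intro exI[of _ UNIV]) auto
next
  case (insert i I)
  then obtain S where S: "AE x in M. x \<in> S"
    "\<And>a. AE x in M. (\<Sum>k\<in>I. a k * f k x) = 0 \<Longrightarrow> \<forall>x\<in>S. (\<Sum>k\<in>I. a k * f k x) = 0" by blast
  show ?case
  proof (cases "\<exists>a. a i \<noteq> 0 \<and> (AE x in M. (\<Sum>k\<in>insert i I. a k * f k x) = 0)")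
    case False
    show ?thesis
    proof (intro exI[of _ S] conjI allI impI ballI)
      show "AE x in M. x \<in> S" by (rule S(1))
      fix a x
      assume a: "AE x in M. (\<Sum>k\<in>insert i I. a k * f k x) = 0" and x: "x \<in> S"
      have "a i = 0" using False a by blast
      then have eq: "(\<Sum>k\<in>insert i I. a k * f k z) = (\<Sum>k\<in>I. a k * f k z)" for z
        using insert.hyps by simp
      show "(\<Sum>k\<in>insert i I. a k * f k x) = 0"
        using S(2)[of a] a x unfolding eq by blast
    qed
  next
    case True
    then obtain a where a: "a i \<noteq> 0" "AE x in M. (\<Sum>k\<in>insert i I. a k * f k x) = 0" by blast
    let ?S = "S \<inter> {x. (\<Sum>k\<in>insert i I. a k * f k x) = 0}"
    have AE: "AE x in M. x \<in> ?S" using S(1) a(2) by eventually_elim simp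
    have "(\<Sum>k\<in>insert i I. b k * f k x) = 0"
      if b: "AE x in M. (\<Sum>k\<in>insert i I. b k * f k x) = 0" and x: "x \<in> ?S" for b x
    proof -
      let ?c = "\<lambda>k. b k - b i / a i * a k"
      have c: "(\<Sum>k\<in>I. ?c k * f k x) =
          (\<Sum>k\<in>insert i I. b k * f k x) - b i / a i * (\<Sum>k\<in>insert i I. a k * f k x)" for x
      proof -
        have "(\<Sum>k\<in>I. ?c k * f k x) = (\<Sum>k\<in>insert i I. ?c k * f k x)"
          using insert.hyps a(1) by simp
        then show ?thesis
          by (simp add: left_diff_distrib sum_subtractf sum_distrib_left mult.assoc)
      qed
      have "AE x in M. (\<Sum>k\<in>I. ?c k * f k x) = 0"
        unfolding c using b a(2) by eventually_elim simp
      from S(2)[OF this] x show ?thesis unfolding c by auto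
    qed
    then show ?thesis using AE by (intro exI[of _ ?S]) blast
  qed
qed

text \<open>A homogeneous linear system with more unknowns than equations has a nontrivial solution.\<close>

lemma exists_linear_relation:
  fixes g :: "'i \<Rightarrow> 'a \<Rightarrow> real"
  assumes "finite I" "finite T" "card I < card T"
  shows "\<exists>u. (\<exists>t\<in>T. u t \<noteq> 0) \<and> (\<forall>k\<in>I. (\<Sum>t\<in>T. u t * g k t) = 0)"
  using assms
proof (induction I arbitrary: T g rule: finite_induct)
  case empty
  then have "T \<noteq> {}" by auto
  then show ?case by (intro exI[of _ "\<lambda>_. 1"]) auto
next
  case (insert i I)
  show ?case
  proof (cases "\<forall>t\<in>T. g i t = 0")
    case True
    obtain u where "\<exists>t\<in>T. u t \<noteq> 0" "\<forall>k\<in>I. (\<Sum>t\<in>T. u t * g k t) = 0"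
      using insert.IH[of T g] insert.prems insert.hyps by auto
    then show ?thesis using True by (intro exI[of _ u]) auto
  next
    case False
    then obtain s where s: "s \<in> T" "g i s \<noteq> 0" by blast
    let ?T = "T - {s}"
    obtain u where u: "\<exists>t\<in>?T. u t \<noteq> 0"
      "\<forall>k\<in>I. (\<Sum>t\<in>?T. u t * (g k t - g k s / g i s * g i t)) = 0"
    proof -
      have "finite ?T" "card I < card ?T" using insert.prems insert.hyps s(1) by auto
      from insert.IH[OF this, of "\<lambda>k t. g k t - g k s / g i s * g i t"] that
      show ?thesis by blast
    qed
    define R where "R = (\<Sum>t\<in>?T. u t * g i t)"
    define v where "v = u(s := - R / g i s)"
    have v: "(\<Sum>t\<in>T. v t * g k t) = - R / g i s * g k s + (\<Sum>t\<in>?T. u t * g k t)" for k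
    proof -
      have "(\<Sum>t\<in>T. v t * g k t) = v s * g k s + (\<Sum>t\<in>?T. v t * g k t)"
        using insert.prems s by (simp add: sum.remove)
      also have "(\<Sum>t\<in>?T. v t * g k t) = (\<Sum>t\<in>?T. u t * g k t)"
        by (rule sum.cong) (auto simp: v_def)
      finally show ?thesis by (simp add: v_def)
    qed
    have "(\<Sum>t\<in>T. v t * g k t) = 0" if "k \<in> insert i I" for k
    proof (cases "k = i")
      case True
      then show ?thesis using s(2) by (simp add: v R_def)
    next
      case False
      then have "0 = (\<Sum>t\<in>?T. u t * (g k t - g k s / g i s * g i t))" using that u(2) by auto
      also have "\<dots> = (\<Sum>t\<in>?T. u t * g k t) - g k s / g i s * R"
        by (simp add: R_def right_diff_distrib sum_subtractf sum_distrib_left mult_ac)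
      finally show ?thesis unfolding v by simp
    qed
    moreover have "\<exists>t\<in>T. v t \<noteq> 0" using u(1) by (auto simp: v_def)
    ultimately show ?thesis by blast
  qed
qed

lemma conic_Caratheodory:
  fixes f :: "'i \<Rightarrow> 'a \<Rightarrow> real"
  assumes I: "finite I" and T: "finite T" and w: "\<forall>t\<in>T. 0 \<le> w t"
  shows "\<exists>T' w'. T' \<subseteq> T \<and> card T' \<le> card I \<and> (\<forall>t\<in>T'. 0 < w' t) \<and>
    (\<forall>k\<in>I. (\<Sum>t\<in>T'. w' t * f k t) = (\<Sum>t\<in>T. w t * f k t))"
  using T w
proof (induction "card T" arbitrary: T w rule: less_induct)
  case less
  have drop: ?case if v: "\<forall>t\<in>T. 0 \<le> v t" and s: "s \<in> T" "v s = 0"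
    and eq: "\<forall>k\<in>I. (\<Sum>t\<in>T. v t * f k t) = (\<Sum>t\<in>T. w t * f k t)" for v s
  proof -
    have "card (T - {s}) < card T" "finite (T - {s})" "\<forall>t\<in>T - {s}. 0 \<le> v t"
      using card_Diff1_less[OF less.prems(1) s(1)] less.prems(1) v by simp_all
    from less.hyps[OF this] obtain T' w' where
      T': "T' \<subseteq> T - {s}" "card T' \<le> card I" "\<forall>t\<in>T'. 0 < w' t"
      "\<forall>k\<in>I. (\<Sum>t\<in>T'. w' t * f k t) = (\<Sum>t\<in>T - {s}. v t * f k t)"
      by blast
    have "(\<Sum>t\<in>T - {s}. v t * f k t) = (\<Sum>t\<in>T. v t * f k t)" for k
      using s less.prems(1) by (simp add: sum.remove)
    with T' eq show ?thesis by (intro exI[of _ T'] exI[of _ w']) auto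
  qed
  show ?case
  proof (cases "\<exists>s\<in>T. w s = 0")
    case True
    then show ?thesis using drop[of w] less.prems by blast
  next
    case False
    then have pos: "\<forall>t\<in>T. 0 < w t" using less.prems(2) by force
    show ?thesis
    proof (cases "card T \<le> card I")
      case True
      then show ?thesis using pos by blast
    next
      case False
      then obtain u0 where u0: "\<exists>t\<in>T. u0 t \<noteq> 0" "\<forall>k\<in>I. (\<Sum>t\<in>T. u0 t * f k t) = 0"
        using exists_linear_relation[OF I less.prems(1), of f] by auto
      obtain u where u: "\<exists>t\<in>T. u t > 0" "\<forall>k\<in>I. (\<Sum>t\<in>T. u t * f k t) = 0"
      proof (cases "\<exists>t\<in>T. u0 t > 0")
        case True
        then show ?thesis using u0 that by blast
      next
        case False
        then have "\<exists>t\<in>T. - u0 t > 0" using u0(1) by force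
        then show ?thesis using u0(2) that[of "\<lambda>t. - u0 t"] by (simp add: sum_negf)
      qed
      let ?P = "{t\<in>T. u t > 0}"
      have P: "finite ?P" "?P \<noteq> {}" using u(1) less.prems(1) by auto
      \<comment> \<open>The node that loses its weight first when a multiple of \<open>u\<close> is subtracted from \<open>w\<close>.\<close>
      define s where "s = arg_min_on (\<lambda>t. w t / u t) ?P"
      have s: "s \<in> T" "u s > 0" using arg_min_if_finite(1)[OF P] by (auto simp: s_def)
      have min: "w s / u s \<le> w t / u t" if "t \<in> ?P" for t
        using arg_min_least[OF P that] by (simp add: s_def)
      let ?v = "\<lambda>t. w t - w s / u s * u t"
      have "0 \<le> ?v t" if t: "t \<in> T" for t
      proof (cases "u t > 0")
        case True
        then show ?thesis using min[of t] t by (simp add: field_simps)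
      next
        case False
        moreover have "0 \<le> w s / u s" using s pos by (simp add: less_imp_le)
        ultimately have "w s / u s * u t \<le> 0" by (intro mult_nonneg_nonpos) auto
        then show ?thesis using pos t by (smt (verit))
      qed
      moreover have "?v s = 0" using s by simp
      moreover have "(\<Sum>t\<in>T. ?v t * f k t) = (\<Sum>t\<in>T. w t * f k t)" if "k \<in> I" for k
      proof -
        have "(\<Sum>t\<in>T. ?v t * f k t) = (\<Sum>t\<in>T. w t * f k t) - w s / u s * (\<Sum>t\<in>T. u t * f k t)"
          by (simp add: left_diff_distrib sum_subtractf sum_distrib_left mult.assoc)
        then show ?thesis using u(2) that by simp
      qed
      ultimately show ?thesis using drop[of ?v s] s by blast
    qed
  qed
qed

text \<open>
  Neither a topology on the space nor finiteness of the measure is needed.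
\<close>

theorem Tchakaloff_quadrature:
  fixes f :: "'i \<Rightarrow> 'a \<Rightarrow> real"
  assumes I: "finite I" and f: "\<And>k. k \<in> I \<Longrightarrow> integrable M (f k)"
  shows "\<exists>T w. finite T \<and> card T \<le> card I \<and> T \<subseteq> space M \<and> (\<forall>t\<in>T. 0 < w t) \<and>
    (\<forall>k\<in>I. (LINT x|M. f k x) = (\<Sum>t\<in>T. w t * f k t))"
proof -
  obtain S0 where S0: "AE x in M. x \<in> S0"
    "\<And>a. AE x in M. (\<Sum>k\<in>I. a k * f k x) = 0 \<Longrightarrow> \<forall>x\<in>S0. (\<Sum>k\<in>I. a k * f k x) = 0"
    using AE_relations_everywhere[OF I, of M f] by blast
  define S where "S = S0 \<inter> space M"
  define y where "y k = (LINT x|M. f k x)" for k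
  \<comment> \<open>Weights are set to \<open>0\<close> outside the node set, so that two formulas can be added on the union of
    their node sets.\<close>
  define C where "C = {\<lambda>k. \<Sum>t\<in>T. w t * f k t | T w.
    finite T \<and> T \<subseteq> S \<and> (\<forall>t. 0 \<le> w t) \<and> (\<forall>t. t \<notin> T \<longrightarrow> w t = (0::real))}"
  have C_I: "(\<lambda>k. \<Sum>t\<in>T. w t * f k t) \<in> C"
    if "finite T" "T \<subseteq> S" "\<forall>t. 0 \<le> w t" "\<forall>t. t \<notin> T \<longrightarrow> w t = 0" for T w
    using that unfolding C_def by blast
  have cone: "coord_cone C"
    unfolding coord_cone_def
  proof (intro conjI ballI allI impI)
    fix c d assume "c \<in> C" "d \<in> C"
    then obtain T w T' w' where T: "finite T" "T \<subseteq> S" "\<forall>t. 0 \<le> w t" "\<forall>t. t \<notin> T \<longrightarrow> w t = 0"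
      "c = (\<lambda>k. \<Sum>t\<in>T. w t * f k t)"
      and T': "finite T'" "T' \<subseteq> S" "\<forall>t. 0 \<le> w' t" "\<forall>t. t \<notin> T' \<longrightarrow> w' t = 0"
      "d = (\<lambda>k. \<Sum>t\<in>T'. w' t * f k t)"
      unfolding C_def by blast
    have "c k = (\<Sum>t\<in>T \<union> T'. w t * f k t)" for k
      unfolding T(5) using T T' by (intro sum.mono_neutral_left) auto
    moreover have "d k = (\<Sum>t\<in>T \<union> T'. w' t * f k t)" for k
      unfolding T'(5) using T T' by (intro sum.mono_neutral_left) auto
    ultimately have "(\<lambda>k. c k + d k) = (\<lambda>k. \<Sum>t\<in>T \<union> T'. (w t + w' t) * f k t)"
      by (simp add: sum.distrib distrib_right)
    also have "\<dots> \<in> C" using T T' by (intro C_I) auto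
    finally show "(\<lambda>k. c k + d k) \<in> C" .
  next
    fix c and s :: real assume "c \<in> C" "s > 0"
    then obtain T w where T: "finite T" "T \<subseteq> S" "\<forall>t. 0 \<le> w t" "\<forall>t. t \<notin> T \<longrightarrow> w t = 0"
      "c = (\<lambda>k. \<Sum>t\<in>T. w t * f k t)"
      unfolding C_def by blast
    have "(\<lambda>k. s * c k) = (\<lambda>k. \<Sum>t\<in>T. (s * w t) * f k t)"
      unfolding T(5) by (simp add: sum_distrib_left mult.assoc)
    also have "\<dots> \<in> C" using T \<open>s > 0\<close> by (intro C_I) auto
    finally show "(\<lambda>k. s * c k) \<in> C" .
  next
    show "(\<lambda>_. 0) \<in> C" using C_I[of "{}" "\<lambda>_. 0"] by simp
  qed
  have gen: "(\<lambda>k. f k x) \<in> C" if "x \<in> S" for x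
    using C_I[of "{x}" "\<lambda>t. of_bool (t = x)"] that by simp
  have "dual_interior I C y"
    unfolding dual_interior_def
  proof (intro allI impI)
    fix a assume a: "\<forall>c\<in>C. 0 \<le> (\<Sum>k\<in>I. a k * c k)"
    have eq: "(\<Sum>k\<in>I. a k * y k) = (LINT x|M. (\<Sum>k\<in>I. a k * f k x))"
      using f by (simp add: y_def)
    have int: "integrable M (\<lambda>x. \<Sum>k\<in>I. a k * f k x)"
      using f by simp
    have nn: "AE x in M. 0 \<le> (\<Sum>k\<in>I. a k * f k x)"
      using S0(1) AE_space by eventually_elim (use a gen in \<open>auto simp: S_def\<close>)
    have "(\<Sum>k\<in>I. a k * c k) = 0" if 0: "(\<Sum>k\<in>I. a k * y k) = 0" and c: "c \<in> C" for c
    proof -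
      have "AE x in M. (\<Sum>k\<in>I. a k * f k x) = 0"
        using integral_nonneg_eq_0_iff_AE[OF int nn] 0 eq by simp
      from S0(2)[OF this] have z: "(\<Sum>k\<in>I. a k * f k x) = 0" if "x \<in> S" for x
        using that unfolding S_def by blast
      obtain T w where T: "T \<subseteq> S" "c = (\<lambda>k. \<Sum>t\<in>T. w t * f k t)"
        using c unfolding C_def by blast
      have "(\<Sum>k\<in>I. a k * c k) = (\<Sum>k\<in>I. \<Sum>t\<in>T. w t * (a k * f k t))"
        unfolding T(2) by (simp add: sum_distrib_left mult_ac)
      also have "\<dots> = (\<Sum>t\<in>T. w t * (\<Sum>k\<in>I. a k * f k t))"
        by (subst sum.swap) (simp add: sum_distrib_left)
      also have "\<dots> = 0" using z T(1) by (intro sum.neutral) auto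
      finally show ?thesis .
    qed
    then show "0 \<le> (\<Sum>k\<in>I. a k * y k) \<and>
        ((\<Sum>k\<in>I. a k * y k) = 0 \<longrightarrow> (\<forall>c\<in>C. (\<Sum>k\<in>I. a k * c k) = 0))"
      using integral_nonneg_AE[OF nn] eq by auto
  qed
  from dual_interior_subset_cone[OF I cone this] obtain T w where
    T: "finite T" "T \<subseteq> S" "\<forall>t. 0 \<le> w t" "\<forall>k\<in>I. y k = (\<Sum>t\<in>T. w t * f k t)"
    unfolding C_def by force
  obtain T' w' where T': "T' \<subseteq> T" "card T' \<le> card I" "\<forall>t\<in>T'. 0 < w' t"
    "\<forall>k\<in>I. (\<Sum>t\<in>T'. w' t * f k t) = (\<Sum>t\<in>T. w t * f k t)"
    using conic_Caratheodory[OF I T(1), of w f] T(3) by auto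
  show ?thesis
  proof (intro exI[of _ T'] exI[of _ w'] conjI)
    show "finite T'" using T' T finite_subset by blast
    show "T' \<subseteq> space M" using T' T by (auto simp: S_def)
  qed (use T T' in \<open>auto simp: y_def\<close>)
qed

section \<open>The upper bound\<close>

lemma cmod_sum_square:
  fixes c z :: "'i \<Rightarrow> complex"
  shows "(cmod (\<Sum>i\<in>A. c i * z i))\<^sup>2 = (\<Sum>i\<in>A. \<Sum>j\<in>A.
    Re (c i * cnj (c j)) * Re (z i * cnj (z j)) - Im (c i * cnj (c j)) * Im (z i * cnj (z j)))"
proof -
  have sq: "(cmod w)\<^sup>2 = Re (w * cnj w)" for w
    unfolding cmod_power2 by (simp add: power2_eq_square)
  have "(cmod (\<Sum>i\<in>A. c i * z i))\<^sup>2 = Re ((\<Sum>i\<in>A. c i * z i) * cnj (\<Sum>j\<in>A. c j * z j))"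
    unfolding sq cnj_sum ..
  also have "\<dots> = Re (\<Sum>i\<in>A. \<Sum>j\<in>A. (c i * cnj (c j)) * (z i * cnj (z j)))"
    unfolding cnj_sum sum_product by (intro arg_cong[of _ _ Re] sum.cong refl) simp
  also have "\<dots> = (\<Sum>i\<in>A. \<Sum>j\<in>A. Re (c i * cnj (c j)) * Re (z i * cnj (z j))
      - Im (c i * cnj (c j)) * Im (z i * cnj (z j)))"
    by (simp only: Re_sum times_complex.simps(1))
  finally show ?thesis .
qed

lemma integrable_mult_cnj:
  fixes f g :: "'a \<Rightarrow> complex"
  assumes "f \<in> borel_measurable M" "g \<in> borel_measurable M"
    "integrable M (\<lambda>x. (cmod (f x))\<^sup>2)" "integrable M (\<lambda>x. (cmod (g x))\<^sup>2)"
  shows "integrable M (\<lambda>x. f x * cnj (g x))"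
proof (rule Bochner_Integration.integrable_bound)
  show "integrable M (\<lambda>x. (cmod (f x))\<^sup>2 + (cmod (g x))\<^sup>2)" using assms by simp
  have "cmod (f x * cnj (g x)) \<le> norm ((cmod (f x))\<^sup>2 + (cmod (g x))\<^sup>2)" for x
    using sum_squares_bound[of "cmod (f x)" "cmod (g x)"]
      mult_nonneg_nonneg[of "cmod (f x)" "cmod (g x)"]
    by (simp add: norm_mult del: mult_nonneg_nonneg zero_le_mult_iff)
  then show "AE x in M. norm (f x * cnj (g x)) \<le> norm ((cmod (f x))\<^sup>2 + (cmod (g x))\<^sup>2)" by simp
  have "cnj \<in> borel_measurable borel"
    by (intro borel_measurable_continuous_onI continuous_intros)
  then show "(\<lambda>x. f x * cnj (g x)) \<in> borel_measurable M"
    using assms by measurable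
qed

lemma L2_function_space_exact_MZ:
  assumes F: "L2_function_space m \<nu> F"
  shows "\<exists>n\<le>m\<^sup>2. F \<in> MZ_class \<nu> n 0"
proof -
  obtain B where B: "finite B" "card B = m" "cfun.span B = F" and FL: "F \<subseteq> L2_functions \<nu>"
    using F unfolding L2_function_space_def by blast
  obtain b where b: "bij_betw b {..<m} B"
    using ex_bij_betw_nat_finite[OF B(1)] B(2) by (auto simp: atLeast0LessThan)
  have bL: "b i \<in> borel_measurable \<nu>" "integrable \<nu> (\<lambda>x. (cmod (b i x))\<^sup>2)" if "i < m" for i
  proof -
    have "b i \<in> B" using b that by (auto simp: bij_betw_def)
    then have "b i \<in> F" using B(3) cfun.span_base by blast
    then show "b i \<in> borel_measurable \<nu>" "integrable \<nu> (\<lambda>x. (cmod (b i x))\<^sup>2)"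
      using FL by (auto simp: L2_functions_def)
  qed
  have bint: "integrable \<nu> (\<lambda>x. b i x * cnj (b j x))" if "i < m" "j < m" for i j
    using that bL by (intro integrable_mult_cnj) auto
  \<comment> \<open>\<open>Re (b i cnj b j)\<close> is symmetric and \<open>Im (b i cnj b j)\<close> is antisymmetric in \<open>i\<close> and \<open>j\<close>, so \<open>m\<^sup>2\<close>
    functions are enough for all the real and imaginary parts.\<close>
  define h where "h = (\<lambda>(i, j) x. if i \<le> j then Re (b i x * cnj (b j x)) else Im (b i x * cnj (b j x)))"
  have hint: "integrable \<nu> (h k)" if k: "k \<in> {..<m} \<times> {..<m}" for k
  proof -
    obtain i j where ij: "k = (i, j)" "i < m" "j < m" using k by auto
    show ?thesis
      using integrable_Re[OF bint[OF ij(2,3)]] integrable_Im[OF bint[OF ij(2,3)]]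
      by (cases "i \<le> j") (simp_all add: h_def ij(1) del: times_complex.simps)
  qed
  have fin: "finite ({..<m} \<times> {..<m})" by simp
  obtain T w where T: "finite T" "card T \<le> m\<^sup>2" "T \<subseteq> space \<nu>" "\<forall>t\<in>T. 0 < w t"
    and quad: "\<And>k. k \<in> {..<m} \<times> {..<m} \<Longrightarrow> (LINT x|\<nu>. h k x) = (\<Sum>t\<in>T. w t * h k t)"
  proof -
    have card: "card ({..<m} \<times> {..<m}) = m\<^sup>2" by (simp add: card_cartesian_product power2_eq_square)
    have "\<exists>T w. finite T \<and> card T \<le> m\<^sup>2 \<and> T \<subseteq> space \<nu> \<and> (\<forall>t\<in>T. 0 < w t) \<and>
        (\<forall>k\<in>{..<m} \<times> {..<m}. (LINT x|\<nu>. h k x) = (\<Sum>t\<in>T. w t * h k t))"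
      using Tchakaloff_quadrature[OF fin, of \<nu> h] hint unfolding card by blast
    then show ?thesis using that by blast
  qed
  have flip: "b i x * cnj (b j x) = cnj (b j x * cnj (b i x))" for i j x by simp
  have Re: "(LINT x|\<nu>. Re (b i x * cnj (b j x))) = (\<Sum>t\<in>T. w t * Re (b i t * cnj (b j t)))"
    if ij: "i < m" "j < m" for i j
  proof (cases "i \<le> j")
    case True
    then show ?thesis using quad[of "(i, j)"] ij by (simp add: h_def del: times_complex.simps)
  next
    case False
    have "Re (b i x * cnj (b j x)) = h (j, i) x" for x
      using False by (subst flip) (simp add: h_def)
    then show ?thesis using quad[of "(j, i)"] ij by simp
  qed
  have Im: "(LINT x|\<nu>. Im (b i x * cnj (b j x))) = (\<Sum>t\<in>T. w t * Im (b i t * cnj (b j t)))"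
    if ij: "i < m" "j < m" for i j
  proof (cases i j rule: linorder_cases)
    case greater
    then show ?thesis using quad[of "(i, j)"] ij by (simp add: h_def del: times_complex.simps)
  next
    case equal
    then have "Im (b i x * cnj (b j x)) = 0" for x by simp
    then show ?thesis by simp
  next
    case less
    have "Im (b i x * cnj (b j x)) = - h (j, i) x" for x
      using less by (subst flip) (simp add: h_def)
    then show ?thesis using quad[of "(j, i)"] ij by (simp add: sum_negf)
  qed
  have exact: "(L2_norm_on \<nu> f)\<^sup>2 = (\<Sum>t\<in>T. w t * (cmod (f t))\<^sup>2)" if f: "f \<in> F" for f
  proof -
    obtain u where u: "f = (\<Sum>v\<in>B. cfun_scale (u v) v)"
      using f B cfun.span_finite[OF B(1)] by auto
    have apply_sum: "(\<Sum>v\<in>A. g v) x = (\<Sum>v\<in>A. g v x)" for A x and g :: "('a \<Rightarrow> complex) \<Rightarrow> 'a \<Rightarrow> complex"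
      by (induction A rule: infinite_finite_induct) auto
    define c where "c i = u (b i)" for i
    have fx: "f x = (\<Sum>i<m. c i * b i x)" for x
      unfolding u apply_sum cfun_scale_def c_def
      by (rule sum.reindex_bij_betw[OF b, symmetric])
    define r s where "r i j = Re (c i * cnj (c j))" and "s i j = Im (c i * cnj (c j))" for i j
    define R J where "R i j x = Re (b i x * cnj (b j x))" and "J i j x = Im (b i x * cnj (b j x))"
      for i j x
    have R: "integrable \<nu> (R i j)" "integral\<^sup>L \<nu> (R i j) = (\<Sum>t\<in>T. w t * R i j t)"
      and J: "integrable \<nu> (J i j)" "integral\<^sup>L \<nu> (J i j) = (\<Sum>t\<in>T. w t * J i j t)"
      if "i < m" "j < m" for i j
      using integrable_Re[OF bint[OF that]] integrable_Im[OF bint[OF that]] Re[OF that] Im[OF that]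
      unfolding R_def J_def by - assumption+
    have sq: "(cmod (f x))\<^sup>2 = (\<Sum>i<m. \<Sum>j<m. r i j * R i j x - s i j * J i j x)" for x
      unfolding fx cmod_sum_square r_def s_def R_def J_def ..
    have int: "integrable \<nu> (\<lambda>x. r i j * R i j x - s i j * J i j x)"
      "(LINT x|\<nu>. r i j * R i j x - s i j * J i j x)
        = r i j * integral\<^sup>L \<nu> (R i j) - s i j * integral\<^sup>L \<nu> (J i j)"
      if "i < m" "j < m" for i j
      using R(1)[OF that] J(1)[OF that] by simp_all
    have "(L2_norm_on \<nu> f)\<^sup>2 = (LINT x|\<nu>. (cmod (f x))\<^sup>2)"
      unfolding L2_norm_on_def by (simp add: integral_nonneg_AE)
    also have "\<dots> = (\<Sum>i<m. \<Sum>j<m. r i j * integral\<^sup>L \<nu> (R i j) - s i j * integral\<^sup>L \<nu> (J i j))"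
    proof -
      have "(LINT x|\<nu>. (cmod (f x))\<^sup>2) = (\<Sum>i<m. LINT x|\<nu>. (\<Sum>j<m. r i j * R i j x - s i j * J i j x))"
        unfolding sq by (intro Bochner_Integration.integral_sum Bochner_Integration.integrable_sum)
          (simp add: int(1))
      also have "\<dots> = (\<Sum>i<m. \<Sum>j<m. LINT x|\<nu>. r i j * R i j x - s i j * J i j x)"
        by (intro sum.cong[OF refl] Bochner_Integration.integral_sum) (simp add: int(1))
      also have "\<dots> = (\<Sum>i<m. \<Sum>j<m. r i j * integral\<^sup>L \<nu> (R i j) - s i j * integral\<^sup>L \<nu> (J i j))"
        by (simp add: int(2))
      finally show ?thesis .
    qed
    also have "\<dots> = (\<Sum>i<m. \<Sum>j<m. \<Sum>t\<in>T. w t * (r i j * R i j t - s i j * J i j t))"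
      by (intro sum.cong refl)
        (simp add: R(2) J(2) sum_distrib_left sum_subtractf right_diff_distrib mult.left_commute)
    also have "\<dots> = (\<Sum>i<m. \<Sum>t\<in>T. \<Sum>j<m. w t * (r i j * R i j t - s i j * J i j t))"
      by (intro sum.cong refl sum.swap)
    also have "\<dots> = (\<Sum>t\<in>T. \<Sum>i<m. \<Sum>j<m. w t * (r i j * R i j t - s i j * J i j t))"
      by (rule sum.swap)
    also have "\<dots> = (\<Sum>t\<in>T. w t * (cmod (f t))\<^sup>2)"
      unfolding sq sum_distrib_left ..
    finally show ?thesis .
  qed
  obtain x where x: "bij_betw x {..<card T} T"
    using ex_bij_betw_nat_finite[OF T(1)] by (auto simp: atLeast0LessThan)
  have "F \<in> MZ_class \<nu> (card T) 0"
    unfolding MZ_class_def MZ_inequality_def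
  proof (intro CollectI exI[of _ x] exI[of _ "w \<circ> x"] conjI ballI)
    show "inj_on x {..<card T}" using x by (simp add: bij_betw_def)
    show "\<forall>i<card T. x i \<in> space \<nu>" "\<forall>i<card T. 0 < (w \<circ> x) i"
      using x T by (auto simp: bij_betw_def)
    fix f assume "f \<in> F"
    then show "(1 - 0) * (L2_norm_on \<nu> f)\<^sup>2 \<le> (\<Sum>i<card T. (w \<circ> x) i * (cmod (f (x i)))\<^sup>2)"
      "(\<Sum>i<card T. (w \<circ> x) i * (cmod (f (x i)))\<^sup>2) \<le> (1 + 0) * (L2_norm_on \<nu> f)\<^sup>2"
      using exact sum.reindex_bij_betw[OF x, of "\<lambda>t. w t * (cmod (f t))\<^sup>2"] by simp_all
  qed
  with T(2) show ?thesis by blast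
qed

lemma MZ_number_le: "MZ_number TYPE('a) m 0 \<le> enat (m\<^sup>2)"
  unfolding MZ_number_def
proof (rule SUP_least, clarify)
  fix \<nu> :: "'a measure" and F assume "L2_function_space m \<nu> F"
  then obtain n where "n \<le> m\<^sup>2" "F \<in> MZ_class \<nu> n 0" using L2_function_space_exact_MZ by blast
  then show "(INF n\<in>{n. F \<in> MZ_class \<nu> n 0}. enat n) \<le> enat (m\<^sup>2)"
    by (intro INF_lower2[of n]) auto
qed

section \<open>The lower bound\<close>

text \<open>
  The value at the point \<open>(i, j)\<close> of the \<open>k\<close>-th basis function of the extremal space, that is, the
  \<open>k\<close>-th coordinate of the vector \<open>e\<^sub>i\<close> if \<open>i = j\<close>, \<open>e\<^sub>i + e\<^sub>j\<close> if \<open>i < j\<close>, and \<open>e\<^sub>i + \<i> e\<^sub>j\<close> if \<open>j < i\<close>.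
\<close>

definition pair_basis :: "nat \<Rightarrow> nat \<times> nat \<Rightarrow> complex" where
  "pair_basis k = (\<lambda>(i, j). of_bool (k = i) +
     (if i < j then of_bool (k = j) else if j < i then \<i> * of_bool (k = j) else 0))"

text \<open>
  For \<open>a < b\<close>, the product of the \<open>a\<close>-th basis function with the conjugate of the \<open>b\<close>-th one detects
  single off-diagonal points: its real part is the indicator of \<open>(a, b)\<close>, its imaginary part that of
  \<open>(b, a)\<close>.
\<close>

lemma pair_basis_mult_cnj:
  assumes "a < b"
  shows "Re (pair_basis a p * cnj (pair_basis b p)) = of_bool (p = (a, b))"
    and "Im (pair_basis a p * cnj (pair_basis b p)) = of_bool (p = (b, a))"
  using assms by (cases p; auto simp: pair_basis_def)+

lemma pair_basis_diagonal: "pair_basis k (i, i) = of_bool (k = i)"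
  by (simp add: pair_basis_def)

text \<open>
  The squared moduli of the linear combinations of the \<open>m\<close> functions span all real functions on the
  \<open>m\<^sup>2\<close> points, stated in dual form: only the zero signed measure \<open>d\<close> annihilates
  them.
\<close>

lemma pair_basis_separating:
  fixes d :: "nat \<times> nat \<Rightarrow> real"
  assumes zero: "\<And>c. (\<Sum>p\<in>{..<m} \<times> {..<m}. d p * (cmod (\<Sum>k<m. c k * pair_basis k p))\<^sup>2) = 0"
    and p: "p \<in> {..<m} \<times> {..<m}"
  shows "d p = 0"
proof -
  let ?P = "{..<m} \<times> {..<m}" and ?e = pair_basis
  have single: "(\<Sum>k<m. s * of_bool (k = a) * z k) = s * z a" if "a < m" for a s and z :: "nat \<Rightarrow> complex"
    using that by (subst sum.remove[of _ a]) (auto intro!: sum.neutral)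
  have one: "(\<Sum>p\<in>?P. d p * (cmod (?e a p))\<^sup>2) = 0" if "a < m" for a
    using zero[of "\<lambda>k. 1 * of_bool (k = a)"] unfolding single[OF that] by simp
  have polar: "(\<Sum>p\<in>?P. d p * Re (?e a p * cnj (s * ?e b p))) = 0"
    if ab: "a < m" "b < m" for a b s
  proof -
    have sum: "(\<Sum>k<m. (1 * of_bool (k = a) + s * of_bool (k = b)) * ?e k p) = ?e a p + s * ?e b p" for p
      unfolding distrib_right sum.distrib single[OF ab(1)] single[OF ab(2)] by simp
    have sq: "(cmod (?e a p + s * ?e b p))\<^sup>2 = (cmod (?e a p))\<^sup>2 + (cmod s)\<^sup>2 * (cmod (?e b p))\<^sup>2
        + 2 * Re (?e a p * cnj (s * ?e b p))" for p
      unfolding cmod_power2 by (simp add: power2_eq_square algebra_simps)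
    have "0 = (\<Sum>p\<in>?P. d p * (cmod (?e a p + s * ?e b p))\<^sup>2)"
      using zero[of "\<lambda>k. 1 * of_bool (k = a) + s * of_bool (k = b)"] unfolding sum by simp
    also have "\<dots> = (\<Sum>p\<in>?P. d p * (cmod (?e a p))\<^sup>2) + (cmod s)\<^sup>2 * (\<Sum>p\<in>?P. d p * (cmod (?e b p))\<^sup>2)
        + 2 * (\<Sum>p\<in>?P. d p * Re (?e a p * cnj (s * ?e b p)))"
      unfolding sq distrib_left sum.distrib sum_distrib_left by (simp only: mult.left_commute)
    finally show ?thesis using one ab by simp
  qed
  have pick: "(\<Sum>p\<in>?P. d p * of_bool (p = q)) = d q" if "q \<in> ?P" for q
    using that by (subst sum.remove[of _ q]) (auto intro!: sum.neutral)
  have off: "d (a, b) = 0 \<and> d (b, a) = 0" if ab: "a < b" "b < m" for a b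
  proof
    have "(\<Sum>p\<in>?P. d p * of_bool (p = (a, b))) = 0"
      using polar[of a b 1] ab unfolding pair_basis_mult_cnj(1)[OF ab(1), symmetric] by simp
    then show "d (a, b) = 0" using pick[of "(a, b)"] ab by simp
    have "Re (z * cnj (\<i> * w)) = Im (z * cnj w)" for z w by simp
    then have "(\<Sum>p\<in>?P. d p * of_bool (p = (b, a))) = 0"
      using polar[of a b \<i>] ab unfolding pair_basis_mult_cnj(2)[OF ab(1), symmetric] by simp
    then show "d (b, a) = 0" using pick[of "(b, a)"] ab by simp
  qed
  obtain i j where ij: "p = (i, j)" "i < m" "j < m" using p by auto
  show ?thesis
  proof (cases i j rule: linorder_cases)
    case equal
    have eq: "d q * (cmod (?e i q))\<^sup>2 = d q * of_bool (q = (i, i))" if "q \<in> ?P" for q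
    proof (cases "fst q" "snd q" rule: linorder_cases)
      case equal
      then show ?thesis by (cases q) (auto simp: pair_basis_diagonal)
    qed (use that off in \<open>cases q, auto\<close>)+
    have "(\<Sum>q\<in>?P. d q * of_bool (q = (i, i))) = (\<Sum>q\<in>?P. d q * (cmod (?e i q))\<^sup>2)"
      by (rule sum.cong) (simp_all only: eq)
    then have "(\<Sum>q\<in>?P. d q * of_bool (q = (i, i))) = 0" using one[of i] ij by simp
    then show ?thesis using pick[of "(i, i)"] ij equal by simp
  qed (use off ij in auto)
qed

lemma exists_space_requiring_square:
  assumes inf: "infinite (UNIV :: 'a set)"
  shows "\<exists>(\<nu> :: 'a measure) F. L2_function_space m \<nu> F \<and> (\<forall>n. F \<in> MZ_class \<nu> n 0 \<longrightarrow> m\<^sup>2 \<le> n)"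
proof -
  let ?I = "{..<m} \<times> {..<m}"
  obtain P :: "'a set" where P: "finite P" "card P = card ?I"
    using infinite_arbitrarily_large[OF inf, of "card ?I"] by auto
  then obtain g where g: "bij_betw g P ?I"
    using finite_same_card_bij[of P ?I] by auto
  have cardP: "card P = m\<^sup>2" using P(2) by (simp add: card_cartesian_product power2_eq_square)
  define \<nu> where "\<nu> = count_space P"
  define e where "e k x = (if x \<in> P then pair_basis k (g x) else 0)" for k x
  define F where "F = range (\<lambda>c :: nat \<Rightarrow> complex. \<lambda>x. \<Sum>k<m. c k * e k x)"
  have apply_sum: "(\<Sum>v\<in>A. h v) x = (\<Sum>v\<in>A. h v x)" for A x and h :: "'b \<Rightarrow> 'a \<Rightarrow> complex"
    by (induction A rule: infinite_finite_induct) auto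
  have norm: "L2_norm_on \<nu> f = L2_set (\<lambda>x. cmod (f x)) P" for f
    using P(1) by (simp add: L2_norm_on_def L2_set_def \<nu>_def lebesgue_integral_count_space_finite)
  have outside: "f x = 0" if "f \<in> F" "x \<notin> P" for f x
    using that by (auto simp: F_def e_def)
  have coeff: "\<exists>x\<in>P. \<forall>k<m. e k x = of_bool (k = i)" if "i < m" for i
  proof -
    have "(i, i) \<in> g ` P" using g that by (simp add: bij_betw_def)
    then obtain x where "x \<in> P" "g x = (i, i)" by auto
    then have "\<forall>k<m. e k x = of_bool (k = i)" by (simp add: e_def pair_basis_diagonal)
    with \<open>x \<in> P\<close> show ?thesis by blast
  qed
  have coeff_zero: "c i = 0" if i: "i < m" and c: "\<And>x. (\<Sum>k<m. c k * e k x) = 0" for c i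
  proof -
    obtain x where "\<forall>k<m. e k x = of_bool (k = i)" using coeff[OF i] by blast
    then have "(\<Sum>k<m. c k * e k x) = (\<Sum>k<m. c k * of_bool (k = i))" by (intro sum.cong) auto
    also have "\<dots> = c i" using i by (subst sum.remove[of _ i]) (auto intro!: sum.neutral)
    finally show ?thesis using c by simp
  qed
  have inj: "inj_on e {..<m}"
  proof (rule inj_onI)
    fix a b assume ab: "a \<in> {..<m}" "b \<in> {..<m}" "e a = e b"
    then obtain x where "\<forall>k<m. e k x = of_bool (k = a)" using coeff[of a] by auto
    then have x: "e a x = of_bool (a = a)" "e b x = of_bool (b = a)" using ab(1,2) by blast+
    have "(of_bool (a = a) :: complex) = of_bool (b = a)"
      by (rule trans[OF x(1)[symmetric] trans[OF fun_cong[OF ab(3)] x(2)]])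
    then show "a = b" by simp
  qed
  have lin: "(\<Sum>v\<in>e ` {..<m}. cfun_scale (u v) v) = (\<lambda>x. \<Sum>k<m. u (e k) * e k x)" for u
    by (rule ext) (simp add: apply_sum cfun_scale_def sum.reindex[OF inj])
  have space: "L2_function_space m \<nu> F"
    unfolding L2_function_space_def
  proof (intro conjI exI[of _ "e ` {..<m}"])
    show "F \<subseteq> L2_functions \<nu>"
    proof
      fix f assume f: "f \<in> F"
      show "f \<in> L2_functions \<nu>"
        using outside[OF f] integrable_count_space[OF P(1)] unfolding L2_functions_def \<nu>_def by simp
    qed
    show "finite (e ` {..<m})" by simp
    show "card (e ` {..<m}) = m" using card_image[OF inj] by simp
    show "cfun.independent (e ` {..<m})"
    proof (subst cfun.dependent_finite)
      show "\<not> (\<exists>u. (\<exists>v\<in>e ` {..<m}. u v \<noteq> 0) \<and> (\<Sum>v\<in>e ` {..<m}. cfun_scale (u v) v) = 0)"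
      proof
        assume "\<exists>u. (\<exists>v\<in>e ` {..<m}. u v \<noteq> 0) \<and> (\<Sum>v\<in>e ` {..<m}. cfun_scale (u v) v) = 0"
        then obtain u i where u: "i < m" "u (e i) \<noteq> 0" "(\<lambda>x. \<Sum>k<m. u (e k) * e k x) = 0"
          unfolding lin by blast
        have "u (e i) = 0"
          by (rule coeff_zero[of i "\<lambda>k. u (e k)"]) (use u(1) fun_cong[OF u(3)] in simp_all)
        with u(2) show False by contradiction
      qed
    qed simp
    show "cfun.span (e ` {..<m}) = F"
    proof -
      have "\<exists>u. (\<lambda>x. \<Sum>k<m. c k * e k x) = (\<lambda>x. \<Sum>k<m. u (e k) * e k x)" for c :: "nat \<Rightarrow> complex"
        by (rule exI[of _ "\<lambda>v. c (the_inv_into {..<m} e v)"])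
          (auto intro!: sum.cong simp: the_inv_into_f_f[OF inj])
      then show ?thesis
        unfolding cfun.span_finite[OF finite_imageI[OF finite_lessThan]] lin F_def by auto
    qed
    show "is_norm_on (L2_norm_on \<nu>) F"
      unfolding is_norm_on_def norm
    proof (intro conjI ballI allI)
      fix f g and c :: complex
      assume f: "f \<in> F"
      show "0 \<le> L2_set (\<lambda>x. cmod (f x)) P" by (rule L2_set_nonneg)
      show "(L2_set (\<lambda>x. cmod (f x)) P = 0) = (f = 0)"
        using P(1) outside[OF f] by (auto simp: L2_set_eq_0_iff fun_eq_iff)
      show "L2_set (\<lambda>x. cmod (cfun_scale c f x)) P = cmod c * L2_set (\<lambda>x. cmod (f x)) P"
        by (simp add: cfun_scale_def norm_mult L2_set_right_distrib)
      have "L2_set (\<lambda>x. cmod ((f + g) x)) P \<le> L2_set (\<lambda>x. cmod (f x) + cmod (g x)) P"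
        by (intro L2_set_mono) (auto intro: norm_triangle_ineq)
      also have "\<dots> \<le> L2_set (\<lambda>x. cmod (f x)) P + L2_set (\<lambda>x. cmod (g x)) P"
        by (rule L2_set_triangle_ineq)
      finally show "L2_set (\<lambda>x. cmod ((f + g) x)) P
          \<le> L2_set (\<lambda>x. cmod (f x)) P + L2_set (\<lambda>x. cmod (g x)) P" .
    qed
  qed
  have "m\<^sup>2 \<le> n" if n: "F \<in> MZ_class \<nu> n 0" for n
  proof -
    obtain x w where x: "\<forall>i<n. x i \<in> P"
      and mz: "\<And>f. f \<in> F \<Longrightarrow> (\<Sum>i<n. w i * (cmod (f (x i)))\<^sup>2) = (L2_norm_on \<nu> f)\<^sup>2"
    proof -
      obtain x w where x: "\<forall>i<n. x i \<in> P"
        and mz: "\<forall>f\<in>F. (L2_norm_on \<nu> f)\<^sup>2 \<le> (\<Sum>i<n. w i * (cmod (f (x i)))\<^sup>2)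
          \<and> (\<Sum>i<n. w i * (cmod (f (x i)))\<^sup>2) \<le> (L2_norm_on \<nu> f)\<^sup>2"
        using n unfolding MZ_class_def MZ_inequality_def by (auto simp: \<nu>_def)
      show ?thesis by (rule that[OF x order.antisym]) (use mz in auto)
    qed
    \<comment> \<open>The difference between the counting measure and the measure of the quadrature formula; it
      equals \<open>1\<close> at a point that is not a node.\<close>
    define d where "d p = 1 - (\<Sum>i | i < n \<and> x i = p. w i)" for p
    have dsum: "(\<Sum>p\<in>P. d p * (cmod (f p))\<^sup>2) = 0" if f: "f \<in> F" for f
    proof -
      have "(\<Sum>i<n. w i * (cmod (f (x i)))\<^sup>2) = (\<Sum>p\<in>P. \<Sum>i | i < n \<and> x i = p. w i * (cmod (f (x i)))\<^sup>2)"
      proof (subst sum.group[of "{..<n}" P x "\<lambda>i. w i * (cmod (f (x i)))\<^sup>2", symmetric])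
        show "x ` {..<n} \<subseteq> P" using x by auto
        show "(\<Sum>p\<in>P. \<Sum>i | i \<in> {..<n} \<and> x i = p. w i * (cmod (f (x i)))\<^sup>2) =
            (\<Sum>p\<in>P. \<Sum>i | i < n \<and> x i = p. w i * (cmod (f (x i)))\<^sup>2)"
          by (simp only: lessThan_iff)
      qed (use P(1) in auto)
      also have "\<dots> = (\<Sum>p\<in>P. (\<Sum>i | i < n \<and> x i = p. w i) * (cmod (f p))\<^sup>2)"
        by (simp add: sum_distrib_right)
      finally have "(\<Sum>p\<in>P. (\<Sum>i | i < n \<and> x i = p. w i) * (cmod (f p))\<^sup>2) = (\<Sum>p\<in>P. (cmod (f p))\<^sup>2)"
        using mz[OF f] by (simp add: norm L2_set_def sum_nonneg)
      then show ?thesis by (simp add: d_def left_diff_distrib sum_subtractf)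
    qed
    let ?g' = "the_inv_into P g"
    have "d (?g' q) = 0" if q: "q \<in> ?I" for q
    proof (rule pair_basis_separating[OF _ q, where d = "\<lambda>q. d (?g' q)"])
      fix c :: "nat \<Rightarrow> complex"
      have "(\<Sum>q\<in>?I. d (?g' q) * (cmod (\<Sum>k<m. c k * pair_basis k q))\<^sup>2) =
          (\<Sum>p\<in>P. d (?g' (g p)) * (cmod (\<Sum>k<m. c k * pair_basis k (g p)))\<^sup>2)"
        by (rule sum.reindex_bij_betw[OF g, symmetric])
      also have "\<dots> = (\<Sum>p\<in>P. d p * (cmod (\<Sum>k<m. c k * e k p))\<^sup>2)"
        using g by (intro sum.cong) (auto simp: bij_betw_def the_inv_into_f_f e_def)
      also have "\<dots> = 0" by (rule dsum) (auto simp: F_def)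
      finally show "(\<Sum>q\<in>?I. d (?g' q) * (cmod (\<Sum>k<m. c k * pair_basis k q))\<^sup>2) = 0" .
    qed
    then have d0: "d p = 0" if "p \<in> P" for p
      using that g by (metis bij_betwE bij_betw_def the_inv_into_f_f)
    have "P \<subseteq> x ` {..<n}"
    proof
      fix p assume p: "p \<in> P"
      have "{i. i < n \<and> x i = p} \<noteq> {}"
      proof
        assume "{i. i < n \<and> x i = p} = {}"
        then have "d p = 1" unfolding d_def by (simp only: sum.empty diff_zero)
        with d0[OF p] show False by simp
      qed
      then show "p \<in> x ` {..<n}" by auto
    qed
    then have "card P \<le> n" using surj_card_le[of "{..<n}" P x] by simp
    then show ?thesis using cardP by simp
  qed
  with space show ?thesis by blast
qed

theorem theorem2p6:
  fixes m :: nat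
  assumes "m \<ge> 1"
  shows "MZ_number TYPE('a) m 0 \<le> enat (m\<^sup>2) \<and>
    (infinite (UNIV :: 'a set) \<longrightarrow> MZ_number TYPE('a) m 0 = enat (m\<^sup>2))"
proof (intro conjI impI)
  show "MZ_number TYPE('a) m 0 \<le> enat (m\<^sup>2)" by (rule MZ_number_le)
  assume "infinite (UNIV :: 'a set)"
  then obtain \<nu> :: "'a measure" and F where F: "L2_function_space m \<nu> F"
    "\<And>n. F \<in> MZ_class \<nu> n 0 \<Longrightarrow> m\<^sup>2 \<le> n"
    using exists_space_requiring_square by blast
  have "enat (m\<^sup>2) \<le> (INF n\<in>{n. F \<in> MZ_class \<nu> n 0}. enat n)"
    using F(2) by (intro INF_greatest) simp
  also have "\<dots> \<le> MZ_number TYPE('a) m 0"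
    unfolding MZ_number_def using F(1) by (intro SUP_upper2[of "(\<nu>, F)"]) auto
  finally show "MZ_number TYPE('a) m 0 = enat (m\<^sup>2)"
    using MZ_number_le by (intro order.antisym)
qed

end
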